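(* Let $g>0$ be a probability density function on $(0,\infty)$ satisfying $$(s(x)g(x))'=\tau(x)g(x),\qquad x>0,$$ where $s$ and $\tau$ are polynomial functions such that $s>0$ on $(0,\infty)$ and $\tau$ is decreasing and has a unique zero $\alpha$ on $(0,\infty)$. Assume that $\lim_{x\to 0}s(x)g(x)=\lim_{x\to\infty}s(x)g(x)=0$. Let $W$ be a random variable with density $g$. If $h$ is a bounded continuous function on $(0,\infty)$ and $$f_h(x)=\frac{1}{s(x)g(x)}\int_0^x g(t)\left[h(t)-\mathbb{E}\,h(W)\right]dt=\frac{-1}{s(x)g(x)}\int_x^{+\infty}g(t)\left[h(t)-\mathbb{E}\,h(W)\right]dt,\qquad x>0,$$ then $$\|f_h\|\le M\,\|h(\cdot)-\mathbb{E}\,h(W)\|,$$ where $$M=\max\left(\frac{1}{s(\alpha)g(\alpha)}\int_0^\alpha g(t)\,dt\,;\ \frac{1}{s(\alpha)g(\alpha)}\int_\alpha^{+\infty}g(t)\,dt\right).$$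
   Context: For a function $u$ on $(0,\infty)$, $\|u\|=\sup_{x>0}|u(x)|$. *)

theory Defs
  imports "HOL-Probability.Probability" "HOL-Computational_Algebra.Polynomial"
begin

text \<open>The supremum is taken in the extended reals, so a finite bound on it
  includes the assertion that \<open>u\<close> is bounded on \<open>(0, \<infinity>)\<close>; a real-valued
  supremum of an unbounded function would be an unspecified value.\<close>

definition sup_norm_pos :: "(real \<Rightarrow> real) \<Rightarrow> ereal" where
  "sup_norm_pos u = (SUP x\<in>{0<..}. ereal \<bar>u x\<bar>)"

text \<open>Here \<open>m\<close> stands for the mean of \<open>h(W)\<close>. Functions on \<open>(0, \<infinity>)\<close> are
  represented by total functions on the reals; their values on \<open>(-\<infinity>, 0]\<close> are irrelevant.\<close>

definition stein_solution ::
    "(real \<Rightarrow> real) \<Rightarrow> (real \<Rightarrow> real) \<Rightarrow> (real \<Rightarrow> real) \<Rightarrow> real \<Rightarrow> real \<Rightarrow> real" where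
  "stein_solution s g h m x =
     1 / (s x * g x) * (LBINT t:{0<..<x}. g t * (h t - m))"

definition stein_constant :: "(real \<Rightarrow> real) \<Rightarrow> (real \<Rightarrow> real) \<Rightarrow> real \<Rightarrow> real" where
  "stein_constant s g \<alpha> =
     max (1 / (s \<alpha> * g \<alpha>) * (LBINT t:{0<..<\<alpha>}. g t))
         (1 / (s \<alpha> * g \<alpha>) * (LBINT t:{\<alpha><..}. g t))"

end

theory Submission
  imports Defs
begin

text \<open>
  Write \<open>q = s g\<close>, let \<open>G x\<close> be the mass that \<open>g\<close> gives to \<open>(0, x)\<close> and \<open>T x\<close> the mass that it
  gives to \<open>(x, \<infinity>)\<close>. Since \<open>q' = \<tau> g\<close> and \<open>G' = g\<close>, the derivative of \<open>q\<close> as a function of the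
  variable \<open>G\<close> is \<open>\<tau>\<close>, which decreases; so \<open>q\<close> is a concave function of \<open>G\<close>. It vanishes at both ends
  of the range of \<open>G\<close>, by the two limit hypotheses. The chord slopes of a concave function from
  the point \<open>(0, 0)\<close> decrease, and those towards the point \<open>(1, 0)\<close> decrease too. In terms of \<open>x\<close>:
  \<open>G / q\<close> is nondecreasing (\<open>lower_mass_ratio_mono\<close>) and \<open>T / q\<close> is nonincreasing
  (\<open>upper_mass_ratio_mono\<close>).

  The function \<open>g (h - m)\<close> has integral \<open>0\<close> over \<open>(0, \<infinity>)\<close>, because \<open>m\<close> is the mean of \<open>h(W)\<close>. Hence
  \<open>f x\<close> can be written with the integral over \<open>(0, x)\<close> or with that over \<open>(x, \<infinity>)\<close>, and \<open>\<bar>f x\<bar>\<close> is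
  at most \<open>\<parallel>h - m\<parallel>\<close> times \<open>G x / q x\<close>, and also at most \<open>\<parallel>h - m\<parallel>\<close> times \<open>T x / q x\<close>. The first
  bound is used for \<open>x \<le> \<alpha>\<close> and the second for \<open>x > \<alpha>\<close>; by the two monotonicity statements neither
  exceeds its value at \<open>x = \<alpha>\<close>.
\<close>

section \<open>Integrals over parts of the positive half-line\<close>

lemma set_integrable_pos_subset:
  fixes f :: "real \<Rightarrow> real"
  assumes "set_integrable lborel {0<..} f" "A \<subseteq> {0<..}" "A \<in> sets borel"
  shows "set_integrable lborel A f"
  using assms by (intro set_integrable_subset[OF assms(1)]) auto

lemma LBINT_insert_endpoint:
  fixes f :: "real \<Rightarrow> real"
  assumes f: "set_integrable lborel {0<..} f" and x: "x > 0"
    and A: "\<And>t. t \<in> A \<Longrightarrow> t > 0" "A \<in> sets borel"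
  shows "(LBINT t:insert x A. f t) = (LBINT t:A. f t)"
proof (rule set_integral_cong_set)
  have meas: "set_borel_measurable lborel B f" if "B \<subseteq> {0<..}" "B \<in> sets borel" for B
    using set_integrable_pos_subset[OF f that]
    unfolding set_borel_measurable_def set_integrable_def by simp
  show "set_borel_measurable lborel A f" "set_borel_measurable lborel (insert x A) f"
    using A x by (auto intro!: meas)
  show "AE t in lborel. (t \<in> A) = (t \<in> insert x A)"
    using AE_lborel_singleton[of x] by eventually_elim auto
qed

lemma LBINT_split_at:
  fixes f :: "real \<Rightarrow> real"
  assumes f: "set_integrable lborel {0<..} f" and x: "x > 0"
  shows "(LBINT t:{0<..}. f t) = (LBINT t:{0<..<x}. f t) + (LBINT t:{x<..}. f t)"
proof -
  have "{0<..} = {0<..<x} \<union> insert x {x<..}"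
    using x by auto
  then have "(LBINT t:{0<..}. f t) = (LBINT t:{0<..<x} \<union> insert x {x<..}. f t)"
    by simp
  also have "\<dots> = (LBINT t:{0<..<x}. f t) + (LBINT t:insert x {x<..}. f t)"
    using x by (intro set_integral_Un set_integrable_pos_subset[OF f]) auto
  also have "(LBINT t:insert x {x<..}. f t) = (LBINT t:{x<..}. f t)"
    using x by (intro LBINT_insert_endpoint[OF f]) auto
  finally show ?thesis .
qed

lemma set_integrable_mult_bounded_continuous:
  fixes g k :: "real \<Rightarrow> real"
  assumes g: "set_integrable lborel {0<..} g"
    and k: "continuous_on {0<..} k" and K: "\<And>t. t > 0 \<Longrightarrow> \<bar>k t\<bar> \<le> K"
  shows "set_integrable lborel {0<..} (\<lambda>t. g t * k t)"
proof (rule set_integrable_bound)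
  show "set_integrable lborel {0<..} (\<lambda>t. K * g t)"
    using g by simp
  have "(\<lambda>t. (indicator {0<..} t *\<^sub>R g t) * (indicator {0<..} t *\<^sub>R k t)) \<in> borel_measurable lborel"
    using g borel_measurable_continuous_on_indicator[OF _ k]
    by (intro borel_measurable_times) (auto simp: set_integrable_def)
  also have "(\<lambda>t. (indicator {0<..} t *\<^sub>R g t) * (indicator {0<..} t *\<^sub>R k t))
      = (\<lambda>t. indicator {0<..} t *\<^sub>R (g t * k t))"
    by (auto simp: indicator_def)
  finally show "set_borel_measurable lborel {0<..} (\<lambda>t. g t * k t)"
    by (simp add: set_borel_measurable_def)
  have "\<bar>g t * k t\<bar> \<le> \<bar>K * g t\<bar>" if "t > 0" for t
    using mult_right_mono[OF order_trans[OF K[OF that] abs_ge_self], of "\<bar>g t\<bar>"]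
    by (simp add: abs_mult mult.commute)
  then show "AE t in lborel. t \<in> {0<..} \<longrightarrow> norm (g t * k t) \<le> norm (K * g t)"
    by auto
qed

lemma abs_LBINT_mult_le:
  fixes g k :: "real \<Rightarrow> real"
  assumes g: "set_integrable lborel A g" and gk: "set_integrable lborel A (\<lambda>t. g t * k t)"
    and pos: "\<And>t. t \<in> A \<Longrightarrow> g t \<ge> 0" and K: "\<And>t. t \<in> A \<Longrightarrow> \<bar>k t\<bar> \<le> K"
  shows "\<bar>LBINT t:A. g t * k t\<bar> \<le> K * (LBINT t:A. g t)"
proof -
  have "\<bar>LBINT t:A. g t * k t\<bar> \<le> (LBINT t:A. \<bar>g t * k t\<bar>)"
    using set_integral_norm_bound[OF gk] by simp
  also have "\<dots> \<le> (LBINT t:A. K * g t)"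
  proof (rule set_integral_mono)
    show "\<bar>g t * k t\<bar> \<le> K * g t" if "t \<in> A" for t
      using mult_right_mono[OF K[OF that] pos[OF that]] pos[OF that]
      by (simp add: abs_mult mult.commute)
  qed (use g gk in \<open>auto intro: set_integrable_abs\<close>)
  finally show ?thesis
    by simp
qed

section \<open>Monotone mass ratios\<close>

text \<open>
  The product \<open>s g\<close> enters the argument only as a function \<open>q\<close> with \<open>dq / dG = \<tau>\<close>. The name
  refers to the concavity of \<open>q\<close> as a function of \<open>G\<close>; the density \<open>g\<close> need not be concave.
\<close>
locale concave_density =
  fixes g q \<tau> :: "real \<Rightarrow> real"
  assumes g_pos: "x > 0 \<Longrightarrow> g x > 0"
    and g_integrable: "set_integrable lborel {0<..} g"
    and g_cont: "x > 0 \<Longrightarrow> isCont g x"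
    and q_pos: "x > 0 \<Longrightarrow> q x > 0"
    and q_deriv: "x > 0 \<Longrightarrow> (q has_real_derivative \<tau> x * g x) (at x)"
    and \<tau>_cont: "x > 0 \<Longrightarrow> isCont \<tau> x"
    and \<tau>_antimono: "antimono_on {0<..} \<tau>"
    and q_lim_0: "(q \<longlongrightarrow> 0) (at_right 0)"
    and q_lim_top: "(q \<longlongrightarrow> 0) at_top"
begin

abbreviation G :: "real \<Rightarrow> real" where "G x \<equiv> LBINT t:{0<..<x}. g t"
abbreviation T :: "real \<Rightarrow> real" where "T x \<equiv> LBINT t:{x<..}. g t"

lemmas g_integrable_on = set_integrable_pos_subset[OF g_integrable]

lemma mass_nonneg:
  assumes "\<And>t. t \<in> A \<Longrightarrow> t > 0"
  shows "0 \<le> (LBINT t:A. g t)"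
  unfolding set_lebesgue_integral_def using assms
  by (intro integral_nonneg_AE AE_I2) (auto simp: indicator_def intro: less_imp_le[OF g_pos])

lemma G_diff:
  assumes "0 < a" "a \<le> b"
  shows "G b - G a = (LBINT t:{a..b}. g t)"
proof -
  have "G b = (LBINT t:insert b {0<..<b}. g t)"
    using assms by (intro LBINT_insert_endpoint[OF g_integrable, symmetric]) auto
  also have "insert b {0<..<b} = {0<..<a} \<union> {a..b}"
    using assms by auto
  also have "(LBINT t:\<dots>. g t) = G a + (LBINT t:{a..b}. g t)"
    using assms by (intro set_integral_Un g_integrable_on) auto
  finally show ?thesis
    by simp
qed

lemma T_diff:
  assumes "0 < a" "a \<le> b"
  shows "T a - T b = G b - G a"
  using LBINT_split_at[OF g_integrable, of a] LBINT_split_at[OF g_integrable, of b] assms by simp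

text \<open>
  This is the concavity of \<open>q\<close> as a function of \<open>G\<close>: over an increment of \<open>G\<close>, the
  slope of \<open>q\<close> lies between the slopes \<open>\<tau> b\<close> and \<open>\<tau> a\<close> at the two ends.
\<close>
lemma q_increment_bounds:
  assumes ab: "0 < a" "a \<le> b"
  shows "\<tau> b * (LBINT t:{a..b}. g t) \<le> q b - q a"
    and "q b - q a \<le> \<tau> a * (LBINT t:{a..b}. g t)"
proof -
  have hb: "has_bochner_integral lborel (\<lambda>t. (\<tau> t * g t) * indicator {a..b} t) (q b - q a)"
    using ab by (intro has_bochner_integral_FTC_Icc_real q_deriv)
      (auto intro!: continuous_intros \<tau>_cont g_cont)
  then have int: "set_integrable lborel {a..b} (\<lambda>t. \<tau> t * g t)"
    and eq: "q b - q a = (LBINT t:{a..b}. \<tau> t * g t)"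
    by (auto simp: set_integrable_def set_lebesgue_integral_def has_bochner_integral_iff mult.commute)
  have g: "set_integrable lborel {a..b} g"
    using ab by (intro g_integrable_on) auto
  have \<tau>: "\<tau> b \<le> \<tau> t" "\<tau> t \<le> \<tau> a" if "t \<in> {a..b}" for t
    using that ab monotone_onD[OF \<tau>_antimono, of a t] monotone_onD[OF \<tau>_antimono, of t b] by auto
  have gpos: "g t \<ge> 0" if "t \<in> {a..b}" for t
    using that ab g_pos[of t] by simp
  have "(LBINT t:{a..b}. \<tau> b * g t) \<le> (LBINT t:{a..b}. \<tau> t * g t)"
    using int g \<tau> gpos by (intro set_integral_mono mult_right_mono) auto
  then show "\<tau> b * (LBINT t:{a..b}. g t) \<le> q b - q a"
    unfolding eq by simp
  have "(LBINT t:{a..b}. \<tau> t * g t) \<le> (LBINT t:{a..b}. \<tau> a * g t)"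
    using int g \<tau> gpos by (intro set_integral_mono mult_right_mono) auto
  then show "q b - q a \<le> \<tau> a * (LBINT t:{a..b}. g t)"
    unfolding eq by simp
qed

text \<open>
  Here the left end of an increment tends to \<open>0\<close>, where \<open>q\<close> vanishes: the tangent slope \<open>\<tau> b\<close>
  is at most the slope of the chord from \<open>(0, 0)\<close>.
\<close>
lemma tangent_le_lower_chord:
  assumes b: "b > 0"
  shows "\<tau> b * G b \<le> q b"
proof -
  have "((\<lambda>a. \<tau> b * (LBINT t:{a..b}. g t)) \<longlongrightarrow> \<tau> b * (LBINT t:{0<..b}. g t)) (at_right 0)"
    using b by (intro tendsto_intros tendsto_set_lebesgue_integral_at_right g_integrable_on) auto
  moreover have "((\<lambda>a. q b - q a) \<longlongrightarrow> q b - 0) (at_right 0)"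
    by (intro tendsto_intros q_lim_0)
  moreover have "eventually (\<lambda>a. \<tau> b * (LBINT t:{a..b}. g t) \<le> q b - q a) (at_right 0)"
    using b eventually_at_right_real[OF b] by (auto elim!: eventually_mono intro: q_increment_bounds)
  ultimately have "\<tau> b * (LBINT t:{0<..b}. g t) \<le> q b - 0"
    by (intro tendsto_le[OF trivial_limit_at_right_real])
  moreover have "insert b {0<..<b} = {0<..b}"
    using b by auto
  then have "(LBINT t:{0<..b}. g t) = G b"
    using LBINT_insert_endpoint[OF g_integrable b, of "{0<..<b}"] by auto
  ultimately show ?thesis
    by simp
qed

text \<open>The mirror image of the previous lemma, with the right end of the increment tending to \<open>\<infinity>\<close>.\<close>
lemma upper_chord_le_tangent:
  assumes a: "a > 0"
  shows "- q a \<le> \<tau> a * T a"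
proof -
  have "((\<lambda>b. \<tau> a * (LBINT t:{a..b}. g t)) \<longlongrightarrow> \<tau> a * (LBINT t:{a..}. g t)) at_top"
    using a by (intro tendsto_intros tendsto_set_lebesgue_integral_at_top g_integrable_on) auto
  moreover have "((\<lambda>b. q b - q a) \<longlongrightarrow> 0 - q a) at_top"
    by (intro tendsto_intros q_lim_top)
  moreover have "eventually (\<lambda>b. q b - q a \<le> \<tau> a * (LBINT t:{a..b}. g t)) at_top"
    using eventually_ge_at_top[of a] by eventually_elim (rule q_increment_bounds(2)[OF a])
  ultimately have "0 - q a \<le> \<tau> a * (LBINT t:{a..}. g t)"
    by (intro tendsto_le[OF trivial_limit_at_top_linorder])
  moreover have "insert a {a<..} = {a..}"
    by auto
  then have "(LBINT t:{a..}. g t) = T a"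
    using LBINT_insert_endpoint[OF g_integrable a, of "{a<..}"] a by auto
  ultimately show ?thesis
    by simp
qed

text \<open>
  The slope of \<open>q\<close> over \<open>[a, b]\<close> is at most \<open>\<tau> a\<close>, hence at most the slope \<open>q a / G a\<close> of the chord
  from \<open>(0, 0)\<close> to the left end; so the chord from \<open>(0, 0)\<close> to the right end is no steeper.
\<close>
lemma lower_mass_ratio_mono:
  assumes ab: "0 < a" "a \<le> b"
  shows "1 / q a * G a \<le> 1 / q b * G b"
proof -
  have incr: "q b - q a \<le> \<tau> a * (G b - G a)" and nonneg: "0 \<le> G b - G a"
    using q_increment_bounds(2)[OF ab] G_diff[OF ab] mass_nonneg[of "{a..b}"] ab by auto
  have "G a * (q b - q a) \<le> G a * (\<tau> a * (G b - G a))"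
    using incr mass_nonneg[of "{0<..<a}"] by (intro mult_left_mono) auto
  also have "\<dots> = (\<tau> a * G a) * (G b - G a)"
    by simp
  also have "\<dots> \<le> q a * (G b - G a)"
    using tangent_le_lower_chord ab nonneg by (intro mult_right_mono) auto
  finally have "G a * q b \<le> G b * q a"
    by (simp add: algebra_simps)
  then show ?thesis
    using ab q_pos[of a] q_pos[of b] by (simp add: field_simps)
qed

text \<open>The mirror image, with the chords that end at the point where \<open>T\<close> and \<open>q\<close> vanish.\<close>
lemma upper_mass_ratio_mono:
  assumes ab: "0 < a" "a \<le> b"
  shows "1 / q b * T b \<le> 1 / q a * T a"
proof -
  have incr: "\<tau> b * (T a - T b) \<le> q b - q a" and nonneg: "0 \<le> T a - T b"
    using q_increment_bounds(1)[OF ab] G_diff[OF ab] T_diff[OF ab] mass_nonneg[of "{a..b}"] ab by auto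
  have "T b * q a - T b * q b \<le> - (T b * (\<tau> b * (T a - T b)))"
    using mult_left_mono[OF incr, of "T b"] mass_nonneg[of "{b<..}"] ab by (simp add: algebra_simps)
  also have "\<dots> = - (\<tau> b * T b) * (T a - T b)"
    by simp
  also have "\<dots> \<le> q b * (T a - T b)"
    using upper_chord_le_tangent[of b] ab nonneg by (intro mult_right_mono) auto
  finally have "T b * q a \<le> T a * q b"
    by (simp add: algebra_simps)
  then show ?thesis
    using ab q_pos[of a] q_pos[of b] by (simp add: field_simps)
qed

section \<open>The bound on the Stein solution\<close>

text \<open>
  Because \<open>g k\<close> has integral \<open>0\<close>, its integrals below and above \<open>x\<close> have the same absolute value,
  so that the mass on either side of \<open>x\<close> gives a bound. Taking the side that does not contain \<open>\<alpha>\<close>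
  makes the bound monotone towards \<open>\<alpha>\<close>.
\<close>
lemma abs_centred_integral_le:
  assumes x: "x > 0" and \<alpha>: "\<alpha> > 0"
    and gk: "set_integrable lborel {0<..} (\<lambda>t. g t * k t)"
    and zero: "(LBINT t:{0<..}. g t * k t) = 0"
    and K: "\<And>t. t > 0 \<Longrightarrow> \<bar>k t\<bar> \<le> K"
  shows "\<bar>1 / q x * (LBINT t:{0<..<x}. g t * k t)\<bar>
    \<le> max (1 / q \<alpha> * G \<alpha>) (1 / q \<alpha> * T \<alpha>) * K"
proof -
  have K0: "K \<ge> 0"
    using K[of 1] by simp
  have le: "\<bar>LBINT t:A. g t * k t\<bar> \<le> K * (LBINT t:A. g t)" if "\<And>t. t \<in> A \<Longrightarrow> t > 0" "A \<in> sets borel" for A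
    using that K by (intro abs_LBINT_mult_le set_integrable_pos_subset[OF gk] g_integrable_on)
      (auto intro: less_imp_le[OF g_pos])
  have qx: "1 / q x \<ge> 0"
    using q_pos[OF x] by simp
  have eq: "\<bar>1 / q x * (LBINT t:{0<..<x}. g t * k t)\<bar> = 1 / q x * \<bar>LBINT t:{0<..<x}. g t * k t\<bar>"
    using qx by (simp add: abs_mult)
  show ?thesis
  proof (cases "x \<le> \<alpha>")
    case True
    have "1 / q x * \<bar>LBINT t:{0<..<x}. g t * k t\<bar> \<le> 1 / q x * (K * G x)"
      using le[of "{0<..<x}"] qx by (intro mult_left_mono) auto
    also have "\<dots> = (1 / q x * G x) * K"
      by simp
    also have "\<dots> \<le> max (1 / q \<alpha> * G \<alpha>) (1 / q \<alpha> * T \<alpha>) * K"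
      using lower_mass_ratio_mono[OF x True] K0 by (intro mult_right_mono max.coboundedI1) auto
    finally show ?thesis
      unfolding eq .
  next
    case False
    have "\<bar>LBINT t:{0<..<x}. g t * k t\<bar> = \<bar>LBINT t:{x<..}. g t * k t\<bar>"
      using LBINT_split_at[OF gk x] zero by linarith
    then have "1 / q x * \<bar>LBINT t:{0<..<x}. g t * k t\<bar> \<le> 1 / q x * (K * T x)"
      using le[of "{x<..}"] qx x by (intro mult_left_mono) auto
    also have "\<dots> = (1 / q x * T x) * K"
      by simp
    also have "\<dots> \<le> max (1 / q \<alpha> * G \<alpha>) (1 / q \<alpha> * T \<alpha>) * K"
      using upper_mass_ratio_mono[OF \<alpha>, of x] False K0
      by (intro mult_right_mono max.coboundedI2) auto
    finally show ?thesis
      unfolding eq .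
  qed
qed

end

lemma expectation_eq_LBINT_density:
  fixes g h :: "real \<Rightarrow> real"
  assumes W: "distributed P (restrict_space lborel {0<..}) W (\<lambda>x. ennreal (g x))"
    and g: "\<And>x. x > 0 \<Longrightarrow> g x \<ge> 0" and h: "continuous_on {0<..} h"
  shows "(\<integral>\<omega>. h (W \<omega>) \<partial>P) = (LBINT t:{0<..}. g t * h t)"
proof -
  have "h \<in> borel_measurable (restrict_space borel {0<..})"
    by (rule borel_measurable_continuous_on_restrict[OF h])
  also have "borel_measurable (restrict_space borel {0<..}) =
      (borel_measurable (restrict_space lborel {0<..}) :: (real \<Rightarrow> real) set)"
    by (intro measurable_cong_sets sets_restrict_space_cong) auto
  finally have "(\<integral>\<omega>. h (W \<omega>) \<partial>P) = (\<integral>t. g t * h t \<partial>restrict_space lborel {0<..})"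
    using g by (intro distributed_integral[OF W, symmetric]) (auto simp: space_restrict_space)
  also have "\<dots> = (LBINT t:{0<..}. g t * h t)"
    by (simp add: integral_restrict_space set_lebesgue_integral_def)
  finally show ?thesis .
qed

theorem proposition2p3:
  fixes s \<tau> :: "real poly" and g h :: "real \<Rightarrow> real" and \<alpha> :: real
    and P :: "'a measure" and W :: "'a \<Rightarrow> real"
  assumes g_pos: "\<And>x. x > 0 \<Longrightarrow> g x > 0"
    and g_integrable: "set_integrable lborel {0<..} g"
    and g_integral: "(LBINT x:{0<..}. g x) = 1"
    and deriv_sg: "\<And>x. x > 0 \<Longrightarrow>
      ((\<lambda>y. poly s y * g y) has_real_derivative poly \<tau> x * g x) (at x)"
    and s_pos: "\<And>x. x > 0 \<Longrightarrow> poly s x > 0"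
    and tau_decreasing: "antimono_on {0<..} (poly \<tau>)"
    and alpha_pos: "\<alpha> > 0"
    and alpha_zero: "poly \<tau> \<alpha> = 0"
    and alpha_unique: "\<And>x. x > 0 \<Longrightarrow> poly \<tau> x = 0 \<Longrightarrow> x = \<alpha>"
    and lim_0: "((\<lambda>x. poly s x * g x) \<longlongrightarrow> 0) (at_right 0)"
    and lim_top: "((\<lambda>x. poly s x * g x) \<longlongrightarrow> 0) at_top"
    and P: "prob_space P"
    and W: "distributed P (restrict_space lborel {0<..}) W (\<lambda>x. ennreal (g x))"
    and h_bounded: "bounded (h ` {0<..})"
    and h_continuous: "continuous_on {0<..} h"
  defines "m \<equiv> prob_space.expectation P (\<lambda>\<omega>. h (W \<omega>))"
  defines "f \<equiv> stein_solution (poly s) g h m"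
  shows "(\<forall>x>0. f x = - 1 / (poly s x * g x) * (LBINT t:{x<..}. g t * (h t - m))) \<and>
    sup_norm_pos f \<le> ereal (stein_constant (poly s) g \<alpha>) * sup_norm_pos (\<lambda>x. h x - m)"
proof -
  \<comment> \<open>\<open>g\<close> is the quotient of the differentiable function \<open>s g\<close> by \<open>s\<close>.\<close>
  have isCont_g: "isCont g x" if "x > 0" for x
  proof -
    have "isCont (\<lambda>y. (poly s y * g y) / poly s y) x"
      using DERIV_isCont[OF deriv_sg[OF that]] s_pos[OF that]
      by (intro isCont_divide) auto
    moreover have "eventually (\<lambda>y. (poly s y * g y) / poly s y = g y) (nhds x)"
      using eventually_nhds_in_open[OF open_greaterThan[of 0], of x] that
      by (auto elim!: eventually_mono dest: s_pos)
    ultimately show ?thesis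
      by (subst (asm) isCont_cong)
  qed
  interpret concave_density g "\<lambda>x. poly s x * g x" "poly \<tau>"
    using g_pos g_integrable isCont_g s_pos deriv_sg tau_decreasing lim_0 lim_top
    by unfold_locales auto

  obtain B\<^sub>h where "\<And>t. t > 0 \<Longrightarrow> \<bar>h t\<bar> \<le> B\<^sub>h"
    using h_bounded by (auto simp: bounded_iff)
  then have B: "\<bar>h t - m\<bar> \<le> B\<^sub>h + \<bar>m\<bar>" if "t > 0" for t
    using that abs_triangle_ineq4[of "h t" m] by (meson add_right_mono order_trans)
  have cont: "continuous_on {0<..} (\<lambda>t. h t - m)"
    using h_continuous by (intro continuous_intros)
  have int: "set_integrable lborel {0<..} (\<lambda>t. g t * (h t - m))"
    by (rule set_integrable_mult_bounded_continuous[OF g_integrable cont B])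
  have int_h: "set_integrable lborel {0<..} (\<lambda>t. g t * h t)"
  proof -
    have "set_integrable lborel {0<..} (\<lambda>t. g t * (h t - m) + g t * m)"
      using int g_integrable by (intro set_integral_add) auto
    then show ?thesis
      by (simp add: algebra_simps)
  qed
  have m: "m = (LBINT t:{0<..}. g t * h t)"
    unfolding m_def using g_pos
    by (intro expectation_eq_LBINT_density[OF W _ h_continuous]) (auto intro: less_imp_le)
  have zero: "(LBINT t:{0<..}. g t * (h t - m)) = 0"
    using int_h g_integrable g_integral m by (simp add: right_diff_distrib set_integral_diff)

  have "f x = - 1 / (poly s x * g x) * (LBINT t:{x<..}. g t * (h t - m))" if "x > 0" for x
  proof -
    have "(LBINT t:{0<..<x}. g t * (h t - m)) = - (LBINT t:{x<..}. g t * (h t - m))"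
      using LBINT_split_at[OF int that] zero by linarith
    then show ?thesis
      by (simp add: f_def stein_solution_def)
  qed
  moreover have "sup_norm_pos f \<le> ereal (stein_constant (poly s) g \<alpha>) * sup_norm_pos (\<lambda>x. h x - m)"
  proof -
    let ?N = "sup_norm_pos (\<lambda>x. h x - m)"
    \<comment> \<open>A real value of the norm turns the extended-real bound into one between reals.\<close>
    have upper: "ereal \<bar>h t - m\<bar> \<le> ?N" if "t > 0" for t
      unfolding sup_norm_pos_def using that by (intro SUP_upper) auto
    have "?N \<le> ereal (B\<^sub>h + \<bar>m\<bar>)"
      unfolding sup_norm_pos_def using B by (intro SUP_least) auto
    moreover have "0 \<le> ?N"
      using order_trans[OF _ upper[of 1]] by simp
    ultimately obtain K where K: "?N = ereal K"
      by (cases ?N) auto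
    have "\<bar>f x\<bar> \<le> stein_constant (poly s) g \<alpha> * K" if "x > 0" for x
      unfolding f_def stein_solution_def stein_constant_def
      using upper K by (intro abs_centred_integral_le[OF that alpha_pos int zero]) auto
    then show ?thesis
      unfolding K by (auto simp: sup_norm_pos_def intro!: SUP_least)
  qed
  ultimately show ?thesis
    by blast
qed

end
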